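(* Let $w\in S_\infty$, $n\ge1$, and let $\varphi$ be a flag that is not the identity. Let $i$ be the smallest positive integer with $\varphi(i)>i$, and let $j=\varphi(i)-1$. If $i>n$ or $j\ge n$, then $\mathrm{RFC}_n(w,\varphi)=\mathrm{RFC}_n(w,\varphi-\mathbf e_i)$. Otherwise, $\mathrm{RFC}_n(w,\varphi)=\mathfrak D^{\mathrm{RF}_n(w)}_j\,\mathrm{RFC}_n(w,\varphi-\mathbf e_i)$.
   Context: $s_i\in S_\infty$ swaps $i,i+1$; reduced words for $w$ are minimal-length words $i_1\cdots i_m$ with $w=s_{i_1}\cdots s_{i_m}$. $\mathrm{RF}_n(w)$ is the set of factorizations $r^{(\bullet)}=(r^{(n)}|\cdots|r^{(1)})$ of reduced words $r=r^{(n)}\cdots r^{(1)}$ for $w$ into exactly $n$ consecutive, possibly empty, strictly increasing subwords. A flag is a weakly increasing $\varphi:\mathbb{Z}_{>0}\to\mathbb{Z}_{>0}$ with $\varphi(m)\ge m$; $(\varphi-\mathbf e_i)(l)=\varphi(l)-\delta_{il}$. $r^{(\bullet)}$ is $\varphi$-flagged if $\varphi(r^{(k)}_1)\ge k$ for each nonempty $r^{(k)}$ (first letter $r^{(k)}_1$). $\mathrm{RFC}_n(w,\varphi)\subseteq\mathrm{RF}_n(w)$ is the set of $\varphi$-flagged elements. Morse–Schilling raising operators on $\mathrm{RF}_n(w)$, $1\le i<n$: take elements $b$ of $r^{(i)}$ in decreasing order, pairing each with the smallest not-yet-paired $a\in r^{(i+1)}$ with $a>b$ (else $b$ unpaired);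 $L_i$ = unpaired letters of $r^{(i+1)}$. If $L_i=\varnothing$, $e_i(r^{(\bullet)})=0$; otherwise with $a=\max L_i$, $s=\min\{t\ge0:a+t+1\notin r^{(i+1)}\}$, $e_i$ removes $a$ from $r^{(i+1)}$ and adds $a+s$ to $r^{(i)}$. Demazure operator: for $X\subseteq\mathrm{RF}_n(w)$, $\mathfrak D^{\mathrm{RF}_n(w)}_jX=\{b\in\mathrm{RF}_n(w):e_j^k(b)\in X\text{ for some }k\ge0\}$. *)

theory Defs
  imports "HOL-Combinatorics.Combinatorics"
begin

text \<open>Positive integers are the natural numbers in \<open>{1..}\<close>; permutations in \<open>S_inf\<close> fix \<open>0\<close>.\<close>

definition S_inf :: "(nat \<Rightarrow> nat) set" where
  "S_inf = {w. w permutes {1..} \<and> finite {x. w x \<noteq> x}}"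

text \<open>The product \<open>s_{i_1} \<cdots> s_{i_m}\<close> composes as functions, rightmost factor first.\<close>

definition word_perm :: "nat list \<Rightarrow> nat \<Rightarrow> nat" where
  "word_perm r = foldr (\<lambda>i f. transpose i (i + 1) \<circ> f) r id"

definition words_for :: "(nat \<Rightarrow> nat) \<Rightarrow> nat list set" where
  "words_for w = {r. set r \<subseteq> {1..} \<and> word_perm r = w}"

definition reduced_words :: "(nat \<Rightarrow> nat) \<Rightarrow> nat list set" where
  "reduced_words w = {r \<in> words_for w. \<forall>r' \<in> words_for w. length r \<le> length r'}"

text \<open>
  A factorization \<open>(r^(n)|\<cdots>|r^(1))\<close> is a function \<open>r\<close> with \<open>r k = r^(k)\<close> for \<open>1 \<le> k \<le> n\<close>,
  extended by the empty word outside this range so that equality of factorizations is equality of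
  functions.
\<close>

type_synonym factorization = "nat \<Rightarrow> nat list"

definition factorization_word :: "nat \<Rightarrow> factorization \<Rightarrow> nat list" where
  "factorization_word n r = concat (map r (rev [1..<n + 1]))"

definition RF :: "nat \<Rightarrow> (nat \<Rightarrow> nat) \<Rightarrow> factorization set" where
  "RF n w = {r. (\<forall>k. k \<notin> {1..n} \<longrightarrow> r k = []) \<and>
                (\<forall>k \<in> {1..n}. sorted_wrt (<) (r k)) \<and>
                factorization_word n r \<in> reduced_words w}"

text \<open>Only the values of a flag on positive integers matter; its value at \<open>0\<close> is arbitrary.\<close>

definition is_flag :: "(nat \<Rightarrow> nat) \<Rightarrow> bool" where
  "is_flag \<phi> \<longleftrightarrow> mono_on {1..} \<phi> \<and> (\<forall>m \<ge> 1. \<phi> m \<ge> m)"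

definition flag_minus :: "(nat \<Rightarrow> nat) \<Rightarrow> nat \<Rightarrow> nat \<Rightarrow> nat" where
  "flag_minus \<phi> i l = \<phi> l - (if l = i then 1 else 0)"

definition flagged :: "nat \<Rightarrow> (nat \<Rightarrow> nat) \<Rightarrow> factorization \<Rightarrow> bool" where
  "flagged n \<phi> r \<longleftrightarrow> (\<forall>k \<in> {1..n}. r k \<noteq> [] \<longrightarrow> \<phi> (hd (r k)) \<ge> k)"

definition RFC :: "nat \<Rightarrow> (nat \<Rightarrow> nat) \<Rightarrow> (nat \<Rightarrow> nat) \<Rightarrow> factorization set" where
  "RFC n w \<phi> = {r \<in> RF n w. flagged n \<phi> r}"

text \<open>
  Here \<open>A\<close> is the set of letters of \<open>r^(i+1)\<close> not paired so far. The factors are increasing,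
  so \<open>rev (r i)\<close> lists the letters of \<open>r^(i)\<close> in decreasing order.
\<close>

definition pair_letter :: "nat \<Rightarrow> nat set \<Rightarrow> nat set" where
  "pair_letter b A = (if \<exists>a \<in> A. a > b then A - {Min {a \<in> A. a > b}} else A)"

definition unpaired :: "nat \<Rightarrow> factorization \<Rightarrow> nat set" where
  "unpaired i r = fold pair_letter (rev (r i)) (set (r (i + 1)))"

text \<open>The value \<open>None\<close> plays the role of the element \<open>0\<close> of the crystal.\<close>

definition raise_op :: "nat \<Rightarrow> factorization \<Rightarrow> factorization option" where
  "raise_op i r =
     (if unpaired i r = {} then None
      else let a = Max (unpaired i r);
               s = (LEAST t. a + t + 1 \<notin> set (r (i + 1)))
           in Some (r(i + 1 := remove1 a (r (i + 1)), i := insort (a + s) (r i))))"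

definition raise_pow :: "nat \<Rightarrow> nat \<Rightarrow> factorization \<Rightarrow> factorization option" where
  "raise_pow i k r = ((\<lambda>x. Option.bind x (raise_op i)) ^^ k) (Some r)"

definition demazure ::
  "nat \<Rightarrow> (nat \<Rightarrow> nat) \<Rightarrow> nat \<Rightarrow> factorization set \<Rightarrow> factorization set" where
  "demazure n w j X = {b \<in> RF n w. \<exists>k. \<exists>x \<in> X. raise_pow j k b = Some x}"

end

theory Submission
  imports Defs
begin

text \<open>
  Let \<open>a\<close> and \<open>s\<close> be as in the definition of \<open>e_j\<close>. A counting argument on the pairing shows that
  \<open>r^(j)\<close> contains \<open>a, \<dots>, a+s-1\<close> and not \<open>a-1\<close>. Commuting distant letters, the word contains the
  block \<open>(a \<dots> a+s)(a \<dots> a+s-1)\<close>, which equals \<open>(a+1 \<dots> a+s)(a \<dots> a+s)\<close> as a permutation; so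
  \<open>e_j\<close> preserves the permutation, and \<open>a+s \<in> r^(j)\<close> would contradict reducedness.

  For \<open>i\<close> and \<open>j\<close> as in the theorem, being \<open>\<phi>\<close>-flagged says about the factors \<open>j\<close> and \<open>j+1\<close> exactly
  that all their letters are at least \<open>i\<close>, and this condition is invariant under \<open>e_j\<close> in both
  directions. Moreover, if all letters of \<open>r^(j+1)\<close> are paired, then \<open>i\<close> is not among them, since
  its partner would be smaller than \<open>i\<close>; this is the condition for \<open>\<phi> - e_i\<close>.
\<close>

section \<open>Words and permutations\<close>

lemma word_perm_Nil [simp]: "word_perm [] = id"
  by (simp add: word_perm_def)

lemma word_perm_Cons: "word_perm (x # u) = transpose x (x + 1) \<circ> word_perm u"
  by (simp add: word_perm_def)

lemma word_perm_append: "word_perm (u @ v) = word_perm u \<circ> word_perm v"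
  by (induction u) (simp_all add: word_perm_Cons comp_assoc)

lemma word_perm_sandwich:
  "word_perm u = word_perm v \<Longrightarrow> word_perm (p @ u @ q) = word_perm (p @ v @ q)"
  by (simp add: word_perm_append)

lemma transpose_commute_distant:
  fixes x y :: nat
  assumes "x + 1 < y \<or> y + 1 < x"
  shows "transpose x (x + 1) \<circ> transpose y (y + 1) = transpose y (y + 1) \<circ> transpose x (x + 1)"
  using assms by (auto simp: fun_eq_iff transpose_def)

lemma word_perm_commute_distant:
  assumes "\<And>x y. x \<in> set u \<Longrightarrow> y \<in> set v \<Longrightarrow> x + 1 < y \<or> y + 1 < x"
  shows "word_perm (u @ v) = word_perm (v @ u)"
proof -
  have letter: "transpose x (x + 1) \<circ> word_perm v = word_perm v \<circ> transpose x (x + 1)"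
    if "\<And>y. y \<in> set v \<Longrightarrow> x + 1 < y \<or> y + 1 < x" for x v
    using that
  proof (induction v)
    case (Cons y v)
    have IH: "transpose x (x + 1) \<circ> word_perm v = word_perm v \<circ> transpose x (x + 1)"
      by (rule Cons.IH) (rule Cons.prems, simp)
    have "transpose x (x + 1) \<circ> word_perm (y # v)
        = (transpose x (x + 1) \<circ> transpose y (y + 1)) \<circ> word_perm v"
      by (simp only: word_perm_Cons comp_assoc)
    also have "\<dots> = transpose y (y + 1) \<circ> (transpose x (x + 1) \<circ> word_perm v)"
      using transpose_commute_distant[of x y] Cons.prems[of y] by (simp add: comp_assoc)
    finally show ?case
      by (simp only: IH word_perm_Cons comp_assoc)
  qed simp
  show ?thesis
    using assms
  proof (induction u)
    case (Cons x u)
    have IH: "word_perm u \<circ> word_perm v = word_perm v \<circ> word_perm u"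
      unfolding word_perm_append[symmetric] by (rule Cons.IH) (rule Cons.prems, simp)
    have "word_perm ((x # u) @ v) = transpose x (x + 1) \<circ> (word_perm u \<circ> word_perm v)"
      by (simp only: word_perm_append word_perm_Cons comp_assoc)
    also have "\<dots> = (transpose x (x + 1) \<circ> word_perm v) \<circ> word_perm u"
      by (simp only: IH comp_assoc)
    also have "\<dots> = word_perm v \<circ> transpose x (x + 1) \<circ> word_perm u"
      using letter[of v x] Cons.prems by simp
    finally show ?case
      by (simp only: word_perm_append word_perm_Cons comp_assoc)
  qed simp
qed

section \<open>Coxeter relations and products of two intervals\<close>

lemma word_perm_square: "word_perm [x, x] = id"
  by (simp add: word_perm_Cons)

lemma word_perm_braid: "word_perm [Suc x, x, Suc x] = word_perm [x, Suc x, x]"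
  by (auto simp: word_perm_Cons fun_eq_iff transpose_def)

text \<open>The two sides are the blocks before and after a raising step. By induction on
  \<open>s\<close>: the new top letter commutes down past \<open>[a..<a + s]\<close>, the shorter
  identity applies, and one braid move on the top two letters gives the new pattern.\<close>

lemma word_perm_shift_interval:
  "word_perm ([a..<a + s + 1] @ [a..<a + s]) = word_perm ([a + 1..<a + s + 1] @ [a..<a + s + 1])"
proof (induction s)
  case (Suc s)
  let ?D = "[a..<a + s]" and ?E = "[a + 1..<a + s + 1]" and ?y = "a + s"
  have swap: "word_perm ([Suc ?y] @ ?D) = word_perm (?D @ [Suc ?y])"
    by (rule word_perm_commute_distant) auto
  have C: "[a..<a + s + 1] = ?D @ [?y]" by simp
  have "word_perm ([a..<a + Suc s + 1] @ [a..<a + Suc s])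
      = word_perm ([a..<a + s + 1] @ ([Suc ?y] @ ?D) @ [?y])"
    by simp
  also have "\<dots> = word_perm ([a..<a + s + 1] @ (?D @ [Suc ?y]) @ [?y])"
    by (intro word_perm_sandwich swap)
  also have "\<dots> = word_perm ([] @ ([a..<a + s + 1] @ ?D) @ [Suc ?y, ?y])"
    by simp
  also have "\<dots> = word_perm ([] @ (?E @ [a..<a + s + 1]) @ [Suc ?y, ?y])"
    by (intro word_perm_sandwich Suc.IH)
  also have "\<dots> = word_perm ((?E @ ?D) @ [?y, Suc ?y, ?y] @ [])"
    by (simp add: C)
  also have "\<dots> = word_perm ((?E @ ?D) @ [Suc ?y, ?y, Suc ?y] @ [])"
    by (intro word_perm_sandwich word_perm_braid[symmetric])
  also have "\<dots> = word_perm (?E @ (?D @ [Suc ?y]) @ [?y, Suc ?y])"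
    by simp
  also have "\<dots> = word_perm (?E @ ([Suc ?y] @ ?D) @ [?y, Suc ?y])"
    by (intro word_perm_sandwich swap[symmetric])
  also have "\<dots> = word_perm ([a + 1..<a + Suc s + 1] @ [a..<a + Suc s + 1])"
    by simp
  finally show ?case .
qed simp

text \<open>Appending \<open>a + s\<close> to both sides of the previous identity produces a square
  on the right, which cancels. The right-hand side is two letters shorter, so no reduced word
  contains the left-hand side as a block.\<close>

lemma word_perm_shift_double_interval:
  "word_perm ([a..<a + s + 1] @ [a..<a + s + 1]) = word_perm ([a + 1..<a + s + 1] @ [a..<a + s])"
proof -
  let ?E = "[a + 1..<a + s + 1]"
  have "word_perm ([a..<a + s + 1] @ [a..<a + s + 1])
      = word_perm ([] @ ([a..<a + s + 1] @ [a..<a + s]) @ [a + s])"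
    by simp
  also have "\<dots> = word_perm ([] @ (?E @ [a..<a + s + 1]) @ [a + s])"
    by (intro word_perm_sandwich word_perm_shift_interval)
  also have "\<dots> = word_perm ((?E @ [a..<a + s]) @ [a + s, a + s] @ [])"
    by simp
  also have "\<dots> = word_perm ((?E @ [a..<a + s]) @ [] @ [])"
    by (intro word_perm_sandwich) (simp add: word_perm_square)
  finally show ?thesis by simp
qed

text \<open>Moving \<open>c\<close> right past \<open>p\<close> and \<open>d\<close> left past
  \<open>q\<close> makes them adjacent; after the replacement the same commutations are undone. In
  use, \<open>p\<close> is the top of \<open>r^(j+1)\<close> and \<open>q\<close> the bottom of
  \<open>r^(j)\<close>.\<close>

lemma word_perm_replace_across:
  assumes cd: "word_perm (c @ d) = word_perm (c' @ d')"
    and "\<And>x y. x \<in> set c \<union> set c' \<Longrightarrow> y \<in> set p \<Longrightarrow> x + 1 < y \<or> y + 1 < x"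
    and "\<And>x y. x \<in> set d \<union> set d' \<Longrightarrow> y \<in> set q \<Longrightarrow> x + 1 < y \<or> y + 1 < x"
  shows "word_perm ((u @ c @ p) @ (q @ d @ v)) = word_perm ((u @ c' @ p) @ (q @ d' @ v))"
proof -
  have merge: "word_perm ((u @ e @ p) @ (q @ f @ v)) = word_perm ((u @ p) @ (e @ f) @ (q @ v))"
    if "set e \<subseteq> set c \<union> set c'" "set f \<subseteq> set d \<union> set d'" for e f
  proof -
    have "word_perm (e @ p) = word_perm (p @ e)"
      using assms(2) that(1) by (intro word_perm_commute_distant) auto
    then have "word_perm (u @ (e @ p) @ (q @ f @ v)) = word_perm (u @ (p @ e) @ (q @ f @ v))"
      by (rule word_perm_sandwich)
    moreover have "word_perm (f @ q) = word_perm (q @ f)"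
      using assms(3) that(2) by (intro word_perm_commute_distant) auto
    then have "word_perm ((u @ p @ e) @ (f @ q) @ v) = word_perm ((u @ p @ e) @ (q @ f) @ v)"
      by (rule word_perm_sandwich)
    ultimately show ?thesis by simp
  qed
  show ?thesis
    using merge[of c d] merge[of c' d'] word_perm_sandwich[OF cd, of "u @ p" "q @ v"] by simp
qed

section \<open>The pairing\<close>

lemma fold_pair_letter_subset: "fold pair_letter bs A \<subseteq> A"
proof (induction bs arbitrary: A)
  case (Cons b bs)
  have "pair_letter b A \<subseteq> A" by (auto simp: pair_letter_def)
  then show ?case using Cons[of "pair_letter b A"] by auto
qed simp

lemma finite_pair_letter: "finite A \<Longrightarrow> finite (pair_letter b A)"
  by (simp add: pair_letter_def)

lemma pair_letter_removed:
  assumes "finite A" "x \<in> A" "x \<notin> pair_letter b A"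
  shows "b < x" and "a \<in> A \<Longrightarrow> b < a \<Longrightarrow> x \<le> a"
proof -
  have x: "x = Min {a \<in> A. a > b}" "\<exists>a \<in> A. a > b"
    using assms by (auto simp: pair_letter_def split: if_splits)
  have "x \<in> {a \<in> A. a > b}"
    unfolding x(1) by (rule Min_in) (use assms(1) x(2) in auto)
  then show "b < x" by simp
  show "x \<le> a" if "a \<in> A" "b < a" using that x(1) assms(1) by auto
qed

text \<open>The witness is the partner of \<open>x\<close>, since a letter is only ever paired with
  a larger one.\<close>

lemma fold_pair_letter_removed_imp_smaller:
  "finite A \<Longrightarrow> x \<in> A \<Longrightarrow> x \<notin> fold pair_letter bs A \<Longrightarrow> \<exists>b \<in> set bs. b < x"
proof (induction bs arbitrary: A)
  case (Cons b bs)
  show ?case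
  proof (cases "x \<in> pair_letter b A")
    case True
    then show ?thesis
      using Cons.IH[of "pair_letter b A"] Cons.prems finite_pair_letter by auto
  next
    case False
    then show ?thesis using pair_letter_removed(1) Cons.prems by auto
  qed
qed simp

text \<open>When \<open>b\<close> is processed, a still present \<open>Suc b\<close> is the least
  candidate above \<open>b\<close>, so \<open>b\<close> would take it.\<close>

lemma fold_pair_letter_survivor_pred:
  "finite A \<Longrightarrow> Suc b \<in> fold pair_letter bs A \<Longrightarrow> b \<notin> set bs"
proof (induction bs arbitrary: A)
  case (Cons c bs)
  have in_pair: "Suc b \<in> pair_letter c A"
    using Cons.prems fold_pair_letter_subset by auto
  have "c \<noteq> b"
  proof
    assume [simp]: "c = b"
    have "Suc b \<in> A" using in_pair by (auto simp: pair_letter_def split: if_splits)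
    moreover from this have "Min {a \<in> A. a > b} = Suc b"
      using Cons.prems(1) by (intro Min_eqI) auto
    ultimately show False using in_pair by (auto simp: pair_letter_def split: if_splits)
  qed
  then show ?case using Cons finite_pair_letter by auto
qed simp

text \<open>
  A letter smaller than a survivor \<open>a\<close> can never be paired with a letter above \<open>a\<close>, so only
  letters in \<open>{a..<c}\<close> are responsible for the losses in \<open>{a<..c}\<close>.
\<close>

lemma fold_pair_letter_count:
  "finite A \<Longrightarrow> distinct bs \<Longrightarrow> a \<in> fold pair_letter bs A \<Longrightarrow>
   card ({a<..c} \<inter> A) \<le> card ({a<..c} \<inter> fold pair_letter bs A) + card (set bs \<inter> {a..<c})"
proof (induction bs arbitrary: A)
  case (Cons b bs)
  let ?A = "pair_letter b A"
  have a: "a \<in> ?A" using Cons.prems fold_pair_letter_subset by auto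
  have IH: "card ({a<..c} \<inter> ?A)
      \<le> card ({a<..c} \<inter> fold pair_letter (b # bs) A) + card (set bs \<inter> {a..<c})"
    using Cons finite_pair_letter by auto
  show ?case
  proof (cases "b \<in> {a..<c}")
    case True
    \<comment> \<open>At most one letter is lost, and \<open>b\<close> itself pays for it on the
      right-hand side.\<close>
    have "{a<..c} \<inter> A \<subseteq> insert (Min {a \<in> A. a > b}) ({a<..c} \<inter> ?A)"
      by (auto simp: pair_letter_def)
    then have "card ({a<..c} \<inter> A) \<le> card (insert (Min {a \<in> A. a > b}) ({a<..c} \<inter> ?A))"
      by (intro card_mono) auto
    also have "\<dots> \<le> Suc (card ({a<..c} \<inter> ?A))" by (rule card_insert_le_m1) auto
    finally show ?thesis using IH True Cons.prems(2) by auto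
  next
    case False
    have "{a<..c} \<inter> A \<subseteq> ?A"
    proof
      fix x assume x: "x \<in> {a<..c} \<inter> A"
      show "x \<in> ?A"
      proof (rule ccontr)
        assume "x \<notin> ?A"
        then have m: "b < x" "\<And>y. y \<in> A \<Longrightarrow> b < y \<Longrightarrow> x \<le> y"
          using pair_letter_removed[of A x b] x Cons.prems(1) by auto
        \<comment> \<open>For \<open>b < a\<close> the survivor \<open>a\<close> is a candidate for
          \<open>b\<close>, so the partner of \<open>b\<close> is at most \<open>a\<close>; for
          \<open>b \<ge> c\<close> the partner lies above \<open>c\<close>.\<close>
        have "a \<in> A" using a by (auto simp: pair_letter_def split: if_splits)
        moreover have "b < a" using m(1) x False by auto
        ultimately have "x \<le> a" using m(2) by blast
        then show False using x by auto
      qed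
    qed
    then have "{a<..c} \<inter> A = {a<..c} \<inter> ?A"
      by (auto simp: pair_letter_def split: if_splits)
    then show ?thesis using IH False by auto
  qed
qed simp

section \<open>Local shape of a raising step\<close>

lemma unpaired_subset: "unpaired i r \<subseteq> set (r (i + 1))"
  unfolding unpaired_def by (rule fold_pair_letter_subset)

text \<open>Maximality of \<open>a\<close> means that all letters of \<open>{a<..a + s}\<close> get
  paired. As \<open>a\<close> survives, counting shows that their partners fill
  \<open>{a..<a + s}\<close>, and \<open>a - 1\<close> cannot occur in \<open>r i\<close> because it
  would have taken \<open>a\<close>.\<close>

lemma raise_op_SomeE:
  assumes "raise_op i r = Some r'" "sorted_wrt (<) (r i)"
  obtains a s where
    "a \<in> unpaired i r" "{a..a + s} \<subseteq> set (r (i + 1))" "a + s + 1 \<notin> set (r (i + 1))"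
    "{a<..a + s} \<inter> unpaired i r = {}" "{a..<a + s} \<subseteq> set (r i)" "\<And>b. b + 1 = a \<Longrightarrow> b \<notin> set (r i)"
    "r' = r(i + 1 := remove1 a (r (i + 1)), i := insort (a + s) (r i))"
proof
  define a where "a = Max (unpaired i r)"
  define s where "s = (LEAST t. a + t + 1 \<notin> set (r (i + 1)))"
  have ne: "unpaired i r \<noteq> {}" and r': "r' = r(i + 1 := remove1 a (r (i + 1)), i := insort (a + s) (r i))"
    using assms(1) by (auto simp: raise_op_def a_def s_def Let_def split: if_splits)
  have fin: "finite (unpaired i r)" using unpaired_subset finite_subset by blast
  show a: "a \<in> unpaired i r" unfolding a_def using fin ne by simp
  show none: "{a<..a + s} \<inter> unpaired i r = {}"
    using fin unfolding a_def by (metis Int_iff Max_ge greaterThanAtMost_iff leD equals0I)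
  \<comment> \<open>The \<open>LEAST\<close> in the definition of \<open>s\<close> is meaningful
    because the factor is finite.\<close>
  have "\<exists>t. a + t + 1 \<notin> set (r (i + 1))"
  proof (rule ccontr)
    assume "\<not> ?thesis"
    then have "(\<lambda>t. a + t + 1) ` UNIV \<subseteq> set (r (i + 1))" by auto
    then have "finite ((\<lambda>t. a + t + 1) ` (UNIV :: nat set))" using finite_subset by blast
    moreover have "inj (\<lambda>t. a + t + 1)" by (simp add: inj_def)
    ultimately show False using finite_imageD infinite_UNIV_nat by blast
  qed
  then show "a + s + 1 \<notin> set (r (i + 1))" unfolding s_def by (rule LeastI_ex)
  show A: "{a..a + s} \<subseteq> set (r (i + 1))"
  proof
    fix x assume x: "x \<in> {a..a + s}"
    show "x \<in> set (r (i + 1))"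
    proof (cases "x = a")
      case True then show ?thesis using a unpaired_subset by auto
    next
      case False
      then have "x - a - 1 < s" "a + (x - a - 1) + 1 = x" using x by auto
      then show ?thesis using not_less_Least[of "x - a - 1" "\<lambda>t. a + t + 1 \<notin> set (r (i + 1))"]
        unfolding s_def by metis
    qed
  qed
  have "distinct (r i)" using assms(2) by (simp add: strict_sorted_iff)
  \<comment> \<open>The count with \<open>c = a + s\<close>, where no survivors contribute.\<close>
  then have "card ({a<..a + s} \<inter> set (r (i + 1))) \<le> card (set (r i) \<inter> {a..<a + s})"
    using fold_pair_letter_count[of "set (r (i + 1))" "rev (r i)" a "a + s"] a none
    unfolding unpaired_def by simp
  moreover have "{a<..a + s} \<inter> set (r (i + 1)) = {a<..a + s}" using A by auto
  ultimately have "card {a..<a + s} \<le> card (set (r i) \<inter> {a..<a + s})" by simp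
  then have "set (r i) \<inter> {a..<a + s} = {a..<a + s}" by (intro card_seteq) auto
  then show "{a..<a + s} \<subseteq> set (r i)" by blast
  show "b \<notin> set (r i)" if "b + 1 = a" for b
    using fold_pair_letter_survivor_pred[of "set (r (i + 1))" b "rev (r i)"] a that
    unfolding unpaired_def by simp
  show "r' = r(i + 1 := remove1 a (r (i + 1)), i := insort (a + s) (r i))" by (fact r')
qed

section \<open>Raising operators preserve reduced factorizations\<close>

text \<open>Strictly increasing lists are determined by their sets. The case \<open>a = c\<close> is
  allowed, as the block in \<open>r^(j)\<close> is empty when \<open>s = 0\<close>.\<close>

lemma strict_sorted_split_interval:
  fixes A :: "nat list"
  assumes "sorted_wrt (<) A" "{a..<c} \<subseteq> set A" "a \<le> c"
  shows "A = filter (\<lambda>x. x < a) A @ [a..<c] @ filter (\<lambda>x. c \<le> x) A"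
proof (rule strict_sorted_equal)
  show "sorted_wrt (<) (filter (\<lambda>x. x < a) A @ [a..<c] @ filter (\<lambda>x. c \<le> x) A)"
    using assms(1,3) by (auto simp: sorted_wrt_append sorted_wrt_filter)
qed (use assms in auto)

lemma factorization_word_split:
  assumes "1 \<le> j" "j < n"
  shows "factorization_word n r = concat (map r (rev [j + 2..<n + 1])) @ (r (j + 1) @ r j)
           @ concat (map r (rev [1..<j]))"
proof -
  have "[1..<n + 1] = [1..<j] @ [j..<n + 1]"
    using assms upt_add_eq_append[of 1 j "n + 1 - j"] by simp
  also have "[j..<n + 1] = j # (j + 1) # [j + 2..<n + 1]"
    using assms by (simp add: upt_conv_Cons)
  finally show ?thesis by (simp add: factorization_word_def)
qed

lemma reduced_words_replace:
  assumes "u \<in> reduced_words w" "word_perm v = word_perm u" "set v \<subseteq> {1..}"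
  shows "length u \<le> length v" and "length v = length u \<Longrightarrow> v \<in> reduced_words w"
  using assms by (auto simp: reduced_words_def words_for_def)

lemma raise_op_in_RF:
  assumes r: "r \<in> RF n w" and j: "1 \<le> j" "j < n" and e: "raise_op j r = Some r'"
  shows "r' \<in> RF n w"
proof -
  have sA: "sorted_wrt (<) (r (j + 1))" and sB: "sorted_wrt (<) (r j)"
    using r j by (auto simp: RF_def)
  obtain a s where A: "{a..a + s} \<subseteq> set (r (j + 1))" "a + s + 1 \<notin> set (r (j + 1))"
    and B: "{a..<a + s} \<subseteq> set (r j)" "\<And>b. b + 1 = a \<Longrightarrow> b \<notin> set (r j)"
    and r': "r' = r(j + 1 := remove1 a (r (j + 1)), j := insort (a + s) (r j))"
    using raise_op_SomeE[OF e sB] by metis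
  define A1 A2 B1 B2 where "A1 = filter (\<lambda>x. x < a) (r (j + 1))"
    and "A2 = filter (\<lambda>x. a + s + 1 \<le> x) (r (j + 1))"
    and "B1 = filter (\<lambda>x. x < a) (r j)" and "B2 = filter (\<lambda>x. a + s + 1 \<le> x) (r j)"
  define U V where "U = concat (map r (rev [j + 2..<n + 1]))"
    and "V = concat (map r (rev [1..<j]))"
  have Aeq: "r (j + 1) = A1 @ [a..<a + s + 1] @ A2"
    unfolding A1_def A2_def by (rule strict_sorted_split_interval) (use sA A in auto)
  have word: "factorization_word n r = U @ (r (j + 1) @ r j) @ V"
    unfolding U_def V_def using factorization_word_split j by blast
  have red: "U @ (r (j + 1) @ r j) @ V \<in> reduced_words w"
    using r word by (simp add: RF_def)
  then have letters: "set (U @ (r (j + 1) @ r j) @ V) \<subseteq> {1..}"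
    unfolding reduced_words_def words_for_def by blast
  \<comment> \<open>The gaps at \<open>a + s + 1\<close> in \<open>r^(j+1)\<close> and at
    \<open>a - 1\<close> in \<open>r^(j)\<close> put \<open>A2\<close> and \<open>B1\<close> at
    distance at least 2 from the blocks, so distant letters commute.\<close>
  have A2: "a + s + 1 < y" if "y \<in> set A2" for y
    using that A(2) by (auto simp: A2_def order_le_less)
  have B1: "y + 1 < a" if "y \<in> set B1" for y
    using that B(2)[of y] by (cases "y + 1 = a") (auto simp: B1_def)
  have new: "a + s \<notin> set (r j)"
  proof
    assume "a + s \<in> set (r j)"
    then have "{a..<a + s + 1} \<subseteq> set (r j)" using B(1) by (auto simp: less_Suc_eq)
    then have Beq: "r j = B1 @ [a..<a + s + 1] @ B2"
      unfolding B1_def B2_def by (intro strict_sorted_split_interval) (use sB in auto)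
    \<comment> \<open>This word omits \<open>a\<close> from the first block and \<open>a + s\<close>
      from the second; being two letters shorter, it contradicts reducedness.\<close>
    let ?v = "(A1 @ [a + 1..<a + s + 1] @ A2) @ (B1 @ [a..<a + s] @ B2)"
    have "word_perm (r (j + 1) @ r j) = word_perm ?v"
      unfolding Aeq Beq
      by (rule word_perm_replace_across[OF word_perm_shift_double_interval]) (auto dest: A2 B1)
    then have "word_perm (U @ ?v @ V) = word_perm (U @ (r (j + 1) @ r j) @ V)"
      by (intro word_perm_sandwich) simp
    moreover have "set (U @ ?v @ V) \<subseteq> {1..}" using letters unfolding Aeq Beq by auto
    ultimately have "length (U @ (r (j + 1) @ r j) @ V) \<le> length (U @ ?v @ V)"
      using reduced_words_replace(1)[OF red] by blast
    then show False unfolding Aeq Beq length_append length_upt by simp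
  qed
  have "r j = B1 @ [a..<a + s] @ filter (\<lambda>x. a + s \<le> x) (r j)"
    unfolding B1_def by (rule strict_sorted_split_interval) (use sB B in auto)
  moreover have "filter (\<lambda>x. a + s \<le> x) (r j) = B2"
    unfolding B2_def using new by (intro filter_cong) (auto simp: Suc_le_eq order_le_less)
  ultimately have Beq: "r j = B1 @ [a..<a + s] @ B2" by simp
  have A': "r' (j + 1) = A1 @ [a + 1..<a + s + 1] @ A2"
  proof -
    have "a \<notin> set A1" by (simp add: A1_def)
    then have "remove1 a (r (j + 1)) = A1 @ remove1 a ([a..<a + s + 1] @ A2)"
      unfolding Aeq by (simp add: remove1_append)
    then show ?thesis by (simp add: r' upt_conv_Cons)
  qed
  have setB': "set (r' j) = insert (a + s) (set (r j))" by (simp add: r' set_insort_key)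
  have sB': "sorted_wrt (<) (r' j)"
    using sB new by (simp add: r' strict_sorted_iff sorted_insort distinct_insort)
  have B': "r' j = B1 @ [a..<a + s + 1] @ B2"
  proof (rule strict_sorted_equal[OF _ sB'])
    have "sorted_wrt (<) B1" "sorted_wrt (<) B2"
      unfolding B1_def B2_def using sB by (auto intro: sorted_wrt_filter)
    then show "sorted_wrt (<) (B1 @ [a..<a + s + 1] @ B2)"
      by (auto simp: sorted_wrt_append B1_def B2_def)
    show "set (r' j) = set (B1 @ [a..<a + s + 1] @ B2)" unfolding setB' Beq by auto
  qed
  have "word_perm (r (j + 1) @ r j) = word_perm (r' (j + 1) @ r' j)"
    unfolding Aeq Beq A' B'
    by (rule word_perm_replace_across[OF word_perm_shift_interval]) (auto dest: A2 B1)
  then have perm: "word_perm (U @ (r' (j + 1) @ r' j) @ V) = word_perm (U @ (r (j + 1) @ r j) @ V)"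
    by (intro word_perm_sandwich) simp
  have "set (U @ (r' (j + 1) @ r' j) @ V) \<subseteq> {1..}"
  proof -
    \<comment> \<open>The inserted letter is positive because it already occurs in
      \<open>r^(j+1)\<close>.\<close>
    have "a + s \<in> set (r (j + 1))" using A(1) by auto
    then have "a + s \<ge> 1" using letters by auto
    moreover have "set (r' (j + 1)) \<subseteq> set (r (j + 1))" by (simp add: r' set_remove1_subset)
    ultimately show ?thesis
      using letters unfolding set_append setB' insert_subset Un_subset_iff atLeast_iff by blast
  qed
  moreover have "length (U @ (r' (j + 1) @ r' j) @ V) = length (U @ (r (j + 1) @ r j) @ V)"
    unfolding A' B' Aeq Beq length_append length_upt by simp
  ultimately have red': "U @ (r' (j + 1) @ r' j) @ V \<in> reduced_words w"
    using reduced_words_replace(2)[OF red perm] by blast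
  have same: "r' k = r k" if "k \<noteq> j" "k \<noteq> j + 1" for k
    using that by (simp add: r')
  have "map r' (rev [j + 2..<n + 1]) = map r (rev [j + 2..<n + 1])"
    "map r' (rev [1..<j]) = map r (rev [1..<j])"
    by (auto simp del: upt_Suc intro!: same)
  then have "factorization_word n r' \<in> reduced_words w"
    using red' unfolding factorization_word_split[OF j, of r'] U_def V_def by metis
  moreover have "sorted_wrt (<) (r' (j + 1))"
    using sA by (simp add: r' strict_sorted_iff sorted_remove1)
  then have "sorted_wrt (<) (r' k)" if "k \<in> {1..n}" for k
    using that r sB' same unfolding RF_def by (cases "k = j \<or> k = j + 1") fastforce+
  moreover have "r' k = []" if "k \<notin> {1..n}" for k
    using that r j same[of k] by (auto simp: RF_def)
  ultimately show ?thesis by (simp add: RF_def)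
qed

section \<open>Iterated raising\<close>

lemma raise_pow_0 [simp]: "raise_pow j 0 r = Some r"
  by (simp add: raise_pow_def)

text \<open>The power is unrolled at its first application, because the later inductions vary the
  starting factorization.\<close>

lemma raise_pow_Suc:
  assumes "raise_op j r = Some r'"
  shows "raise_pow j (Suc k) r = raise_pow j k r'"
  using assms by (simp add: raise_pow_def funpow_Suc_right del: funpow.simps)

lemma raise_pow_Suc_None:
  assumes "raise_op j r = None"
  shows "raise_pow j (Suc k) r = None"
proof -
  have "((\<lambda>x. Option.bind x (raise_op j)) ^^ k) None = None" by (induction k) auto
  then show ?thesis using assms by (simp add: raise_pow_def funpow_Suc_right del: funpow.simps)
qed

text \<open>Each raising step takes one letter out of \<open>r (j + 1)\<close>, so iteration
  terminates, and closure keeps it inside \<open>S\<close>.\<close>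

lemma raise_pow_to_highest:
  assumes "\<And>r r'. r \<in> S \<Longrightarrow> raise_op j r = Some r' \<Longrightarrow> r' \<in> S" "r \<in> S"
  shows "\<exists>k. \<exists>x \<in> S. raise_pow j k r = Some x \<and> unpaired j x = {}"
  using assms(2)
proof (induction "length (r (j + 1))" arbitrary: r rule: less_induct)
  case less
  show ?case
  proof (cases "raise_op j r")
    case None
    then have "unpaired j r = {}" by (auto simp: raise_op_def Let_def split: if_splits)
    then show ?thesis using less.prems by (intro exI[of _ 0]) auto
  next
    case (Some r')
    let ?a = "Max (unpaired j r)"
    have ne: "unpaired j r \<noteq> {}" and r': "r' (j + 1) = remove1 ?a (r (j + 1))"
      using Some by (auto simp: raise_op_def Let_def split: if_splits)
    have "finite (unpaired j r)" using unpaired_subset finite_subset by blast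
    then have "?a \<in> set (r (j + 1))" using ne unpaired_subset Max_in by blast
    then have "length (r' (j + 1)) < length (r (j + 1))"
      unfolding r' by (metis One_nat_def Suc_pred length_pos_if_in_set length_remove1 lessI)
    then obtain k x where "x \<in> S" "raise_pow j k r' = Some x" "unpaired j x = {}"
      using less.hyps assms(1)[OF less.prems Some] by blast
    then show ?thesis using raise_pow_Suc[OF Some] by metis
  qed
qed

section \<open>Flags\<close>

lemma RF_letters_pos:
  assumes "r \<in> RF n w" "k \<in> {1..n}" "l \<in> set (r k)"
  shows "1 \<le> l"
  using assms by (fastforce simp: RF_def factorization_word_def reduced_words_def words_for_def)

text \<open>The first letter of a factor is its smallest, and \<phi> is monotone on positive
  integers. The condition thus depends only on the sets of letters, which is the form compared under
  raising.\<close>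

lemma flagged_iff_all_letters:
  assumes "r \<in> RF n w" "is_flag \<phi>"
  shows "flagged n \<phi> r \<longleftrightarrow> (\<forall>k \<in> {1..n}. \<forall>l \<in> set (r k). k \<le> \<phi> l)"
proof
  assume fl: "flagged n \<phi> r"
  show "\<forall>k \<in> {1..n}. \<forall>l \<in> set (r k). k \<le> \<phi> l"
  proof (intro ballI)
    fix k l assume k: "k \<in> {1..n}" and l: "l \<in> set (r k)"
    have "hd (r k) \<le> l"
    proof -
      have "sorted_wrt (<) (r k)" using assms(1) k by (simp add: RF_def)
      then show ?thesis using l by (cases "r k") auto
    qed
    moreover have "hd (r k) \<ge> 1" "l \<ge> 1"
      using RF_letters_pos[OF assms(1) k] l by (cases "r k"; auto)+
    ultimately have "\<phi> (hd (r k)) \<le> \<phi> l"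
      using assms(2) by (auto simp: is_flag_def mono_on_def)
    moreover have "r k \<noteq> []" using l by auto
    then have "k \<le> \<phi> (hd (r k))" using fl k by (simp add: flagged_def)
    ultimately show "k \<le> \<phi> l" by simp
  qed
qed (auto simp: flagged_def)

text \<open>By \<open>thr\<close>, both affected factors carry the same condition, that letters are
  at least \<open>i\<close>. Replacing \<open>a\<close> by \<open>a + s \<ge> a\<close> preserves
  it; conversely, \<open>a < i \<le> a + s\<close> has to be excluded.\<close>

lemma raise_op_flagged_iff:
  assumes \<phi>: "is_flag \<phi>" and j: "1 \<le> j" "j < n"
    and thr: "\<And>l. 1 \<le> l \<Longrightarrow> j \<le> \<phi> l \<longleftrightarrow> i \<le> l" "\<And>l. 1 \<le> l \<Longrightarrow> j + 1 \<le> \<phi> l \<longleftrightarrow> i \<le> l"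
    and r: "r \<in> RF n w" and e: "raise_op j r = Some r'"
  shows "flagged n \<phi> r' \<longleftrightarrow> flagged n \<phi> r"
proof -
  have r'RF: "r' \<in> RF n w" using raise_op_in_RF[OF r j e] .
  have split: "flagged n \<phi> x \<longleftrightarrow> (\<forall>l \<in> set (x (j + 1)) \<union> set (x j). i \<le> l) \<and>
      (\<forall>k \<in> {1..n} - {j, j + 1}. \<forall>l \<in> set (x k). k \<le> \<phi> l)" if x: "x \<in> RF n w" for x
  proof -
    have "{1..n} = {j, j + 1} \<union> ({1..n} - {j, j + 1})" using j by auto
    then have "flagged n \<phi> x \<longleftrightarrow> (\<forall>l \<in> set (x j). j \<le> \<phi> l) \<and> (\<forall>l \<in> set (x (j + 1)). j + 1 \<le> \<phi> l) \<and>
      (\<forall>k \<in> {1..n} - {j, j + 1}. \<forall>l \<in> set (x k). k \<le> \<phi> l)"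
      unfolding flagged_iff_all_letters[OF x \<phi>] by auto
    moreover have "(\<forall>l \<in> set (x j). j \<le> \<phi> l) \<longleftrightarrow> (\<forall>l \<in> set (x j). i \<le> l)"
      using thr(1) RF_letters_pos[OF x, of j] j by auto
    moreover have "(\<forall>l \<in> set (x (j + 1)). j + 1 \<le> \<phi> l) \<longleftrightarrow> (\<forall>l \<in> set (x (j + 1)). i \<le> l)"
      using thr(2) RF_letters_pos[OF x, of "j + 1"] j by auto
    ultimately show ?thesis by auto
  qed
  have sA: "sorted_wrt (<) (r (j + 1))" and sB: "sorted_wrt (<) (r j)"
    using r j by (auto simp: RF_def)
  obtain a s where A: "{a..a + s} \<subseteq> set (r (j + 1))"
    and max: "{a<..a + s} \<inter> unpaired j r = {}"
    and r': "r' = r(j + 1 := remove1 a (r (j + 1)), j := insort (a + s) (r j))"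
    using raise_op_SomeE[OF e sB] by metis
  have sets: "set (r' (j + 1)) = set (r (j + 1)) - {a}" "set (r' j) = insert (a + s) (set (r j))"
    "\<And>k. k \<notin> {j, j + 1} \<Longrightarrow> r' k = r k"
    using sA by (auto simp: r' strict_sorted_iff set_insort_key)
  have a: "a \<in> set (r (j + 1))" using A by auto
  have "(\<forall>l \<in> set (r' (j + 1)) \<union> set (r' j). i \<le> l) \<longleftrightarrow> (\<forall>l \<in> set (r (j + 1)) \<union> set (r j). i \<le> l)"
  proof
    assume *: "\<forall>l \<in> set (r' (j + 1)) \<union> set (r' j). i \<le> l"
    have "i \<le> a"
    proof (rule ccontr)
      assume "\<not> i \<le> a"
      moreover have "i \<le> a + s" using * sets by auto
      ultimately have "i \<in> {a<..a + s}" by auto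
      \<comment> \<open>Here \<open>s \<ge> 1\<close>, so \<open>a + 1\<close> remains in the factor
        \<open>j + 1\<close> after raising. This forces \<open>i = a + 1\<close>, and its partner in
        \<open>r j\<close> is a letter below \<open>i\<close> that also remains.\<close>
      then have "a + 1 \<in> {a<..a + s}" "a + 1 \<in> set (r (j + 1))" using A by auto
      moreover from this have "i \<le> a + 1" using * sets by auto
      ultimately have "a + 1 \<notin> unpaired j r" "i = a + 1" using max \<open>\<not> i \<le> a\<close> by (blast, linarith)
      then obtain b where b: "b \<in> set (r j)" "b < i"
        using fold_pair_letter_removed_imp_smaller[of "set (r (j + 1))" i "rev (r j)"]
          \<open>a + 1 \<in> set (r (j + 1))\<close> unfolding unpaired_def by auto
      have "i \<le> b" using * sets(2) b(1) by blast
      then show False using b(2) by simp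
    qed
    then show "\<forall>l \<in> set (r (j + 1)) \<union> set (r j). i \<le> l" using * sets by auto
  next
    assume *: "\<forall>l \<in> set (r (j + 1)) \<union> set (r j). i \<le> l"
    then have "i \<le> a + s" using a trans_le_add1 by blast
    then show "\<forall>l \<in> set (r' (j + 1)) \<union> set (r' j). i \<le> l"
      unfolding sets(1,2) using * by blast
  qed
  then show ?thesis unfolding split[OF r] split[OF r'RF] using sets(3) by auto
qed

section \<open>Comparison of the flags \<phi> and \<phi> - e_i\<close>

theorem theorem4p5:
  fixes w \<phi> :: "nat \<Rightarrow> nat" and n i j :: nat
  assumes "w \<in> S_inf"
    and "n \<ge> 1"
    and "is_flag \<phi>"
    and "\<exists>m \<ge> 1. \<phi> m \<noteq> m"
    and "i = (LEAST m. m \<ge> 1 \<and> \<phi> m > m)"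
    and "j = \<phi> i - 1"
  shows "(i > n \<or> j \<ge> n \<longrightarrow> RFC n w \<phi> = RFC n w (flag_minus \<phi> i)) \<and>
         (\<not> (i > n \<or> j \<ge> n) \<longrightarrow> RFC n w \<phi> = demazure n w j (RFC n w (flag_minus \<phi> i)))"
proof -
  have ge: "m \<le> \<phi> m" if "m \<ge> 1" for m using assms(3) that by (simp add: is_flag_def)
  then have "\<exists>m. m \<ge> 1 \<and> \<phi> m > m" using assms(4) by (metis order_le_less)
  then have i: "i \<ge> 1" "\<phi> i > i" unfolding assms(5) by (metis (mono_tags, lifting) LeastI_ex)+
  have below: "\<phi> l = l" if "1 \<le> l" "l < i" for l
    using not_less_Least[of l "\<lambda>m. m \<ge> 1 \<and> \<phi> m > m"] that ge[of l] unfolding assms(5) by auto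
  have above: "\<phi> i \<le> \<phi> l" if "i \<le> l" for l
    using assms(3) that i(1) by (auto simp: is_flag_def mono_on_def)
  have j: "\<phi> i = j + 1" "i \<le> j" "1 \<le> j" using i assms(6) by auto
  \<comment> \<open>Below \<open>i\<close> the flag is the identity, with values less than
    \<open>i \<le> j\<close>; from \<open>i\<close> on its values are at least \<open>j + 1\<close>.
    Both thresholds therefore cut at \<open>i\<close>.\<close>
  have thr: "j \<le> \<phi> l \<longleftrightarrow> i \<le> l" "j + 1 \<le> \<phi> l \<longleftrightarrow> i \<le> l" if "1 \<le> l" for l
    using below[of l] above[of l] j that by (cases "l < i"; auto)+
  have fm: "flag_minus \<phi> i l = (if l = i then j else \<phi> l)" for l
    using j by (simp add: flag_minus_def)
  \<comment> \<open>Lowering \<phi> at \<open>i\<close> from \<open>j + 1\<close> to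
    \<open>j\<close> matters only for a factor of index \<open>j + 1\<close> with first letter
    \<open>i\<close>, and such a factor exists only if \<open>j < n\<close>.\<close>
  have minus: "flagged n (flag_minus \<phi> i) r \<longleftrightarrow>
      flagged n \<phi> r \<and> \<not> (j < n \<and> r (j + 1) \<noteq> [] \<and> hd (r (j + 1)) = i)" for r
  proof -
    have "k \<le> flag_minus \<phi> i l \<longleftrightarrow> k \<le> \<phi> l \<and> \<not> (l = i \<and> k = j + 1)" for k l
      using j by (auto simp: fm)
    then show ?thesis by (auto simp: flagged_def)
  qed
  show ?thesis
  proof (intro conjI impI)
    assume "i > n \<or> j \<ge> n"
    \<comment> \<open>As \<open>i \<le> j\<close>, the case \<open>i > n\<close> also gives
      \<open>j \<ge> n\<close>.\<close>
    then show "RFC n w \<phi> = RFC n w (flag_minus \<phi> i)" using j by (auto simp: RFC_def minus)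
  next
    assume "\<not> (i > n \<or> j \<ge> n)"
    then have jn: "j < n" by simp
    have inv: "flagged n \<phi> r' \<longleftrightarrow> flagged n \<phi> r"
      if "r \<in> RF n w" "raise_op j r = Some r'" for r r'
      using raise_op_flagged_iff[OF assms(3) j(3) jn thr that] .
    show "RFC n w \<phi> = demazure n w j (RFC n w (flag_minus \<phi> i))"
    proof (intro equalityI subsetI)
      fix b assume b: "b \<in> RFC n w \<phi>"
      have "r' \<in> RFC n w \<phi>" if "r \<in> RFC n w \<phi>" "raise_op j r = Some r'" for r r'
        using that inv raise_op_in_RF[OF _ j(3) jn] by (auto simp: RFC_def)
      then obtain k x where x: "x \<in> RFC n w \<phi>" "raise_pow j k b = Some x" "unpaired j x = {}"
        using raise_pow_to_highest[of "RFC n w \<phi>" j b] b by blast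
      \<comment> \<open>All letters of this factor are paired, so \<open>i\<close> would have a
        partner \<open>c < i\<close> in \<open>x j\<close>, violating the flag condition
        there.\<close>
      have "i \<notin> set (x (j + 1))"
      proof
        assume "i \<in> set (x (j + 1))"
        then obtain c where c: "c \<in> set (x j)" "c < i"
          using fold_pair_letter_removed_imp_smaller[of "set (x (j + 1))" i "rev (x j)"] x(3)
          unfolding unpaired_def by auto
        have "x \<in> RF n w" "flagged n \<phi> x" using x(1) by (auto simp: RFC_def)
        then have "j \<le> \<phi> c" "1 \<le> c"
          using flagged_iff_all_letters[OF _ assms(3)] RF_letters_pos[of x n w j c] c j(3) jn by auto
        then show False using thr(1)[of c] c by auto
      qed
      then have "x \<in> RFC n w (flag_minus \<phi> i)" using x(1) hd_in_set by (auto simp: RFC_def minus)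
      then show "b \<in> demazure n w j (RFC n w (flag_minus \<phi> i))"
        using b x(2) by (auto simp: demazure_def RFC_def)
    next
      fix b assume "b \<in> demazure n w j (RFC n w (flag_minus \<phi> i))"
      then obtain k x where b: "b \<in> RF n w" and "flagged n \<phi> x" "raise_pow j k b = Some x"
        by (auto simp: demazure_def RFC_def minus)
      \<comment> \<open>Flaggedness is pulled back from \<open>x\<close> along the raising steps.
        \<open>None\<close> is absorbing, so every step on the way to \<open>x\<close> is
        defined.\<close>
      from this have "flagged n \<phi> b"
      proof (induction k arbitrary: b)
        case (Suc k)
        show ?case
        proof (cases "raise_op j b")
          case None
          then show ?thesis using Suc.prems raise_pow_Suc_None by simp
        next
          case (Some r')
          then have "flagged n \<phi> r'"
            using Suc.IH[of r'] Suc.prems raise_pow_Suc raise_op_in_RF[OF _ j(3) jn] by simp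
          then show ?thesis using inv Suc.prems(1) Some by blast
        qed
      qed simp
      then show "b \<in> RFC n w \<phi>" using b by (simp add: RFC_def)
    qed
  qed
qed

end
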